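(* Let $\mathcal{K}(\mathbb{M}_2)\cong\mathbb{R}^6$ be the space of Killing $2$-tensors of the Minkowski plane with coordinates $(A,B,C,\alpha,\beta,\gamma)$, and let $G_M$, $R_0,R_1,R_2$, $S_1,S_2,S_3,S_4$ be as defined in the context. The set $(S_1\cap S_2)\setminus(S_3\cup S_4)$ contains $8$ connected components. They can be linked together using the three discrete transformations $R_0$, $R_1$ and $R_2$ (i.e. any component is mapped onto any other by some composition of these), and so they form a unique orbit of the action of $G_M$.
   Context: In the Minkowski plane $\mathbb{M}_2$ with pseudo-Cartesian coordinates $(t,x)$ and metric $\mathbf{g}$ with contravariant components $\mathrm{diag}(1,-1)$, the general Killing $2$-tensor has contravariant components $K^{11}=A+2\alpha x+\gamma x^2$, $K^{12}=K^{21}=C+\alpha t+\beta x+\gamma tx$, $K^{22}=B+2\beta t+\gamma t^2$, with $A,B,C,\alpha,\beta,\gamma\in\mathbb{R}$. So the vector space $\mathcal{K}(\mathbb{M}_2)$ of Killing $2$-tensors is identified with $\mathbb{R}^6$ with coordinates $(A,B,C,\alpha,\beta,\gamma)$. With respect to $(\partial_A,\partial_B,\partial_C,\partial_\alpha,\partial_\beta,\partial_\gamma)$ define the vector fields on $\mathcal{K}(\mathbb{M}_2)$: $V_1=(0,-2\beta,-\alpha,0,-\gamma,0)$ and $V_2=(-2\alpha,0,-\beta,-\gamma,0,0)$ (translations); $V_3=(2C,2C,A+B,\beta,\alpha,0)$ (boost); $V_4=(2A,2B,2C,\alpha,\beta,0)$ (dilatation of the plane); $V_5=(1,-1,0,0,0,0)$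 (addition of a multiple of the metric); $V_6=(A,B,C,\alpha,\beta,\gamma)$ (scalar multiplication). Discrete transformations of $\mathcal{K}(\mathbb{M}_2)$ (unlisted coordinates are unchanged): $R_0:\mathbf{K}\mapsto-\mathbf{K}$; $R_1: C\mapsto-C,\ \alpha\mapsto-\alpha$; $R_2: C\mapsto-C,\ \beta\mapsto-\beta$. $G_M$ is the group of transformations of $\mathcal{K}(\mathbb{M}_2)$ generated by the flows of $V_1,\dots,V_6$ and by $R_0,R_1,R_2$. $S_1=\{\gamma=0\}$; $S_2=\{[\gamma(A+B-2C)-(\alpha-\beta)^2]\,[\gamma(A+B+2C)-(\alpha+\beta)^2]=0\}$; $S_3=\{\gamma(A+B)=\alpha^2+\beta^2,\ \gamma C=\alpha\beta\}$; $S_4=\{\gamma=0,\ \alpha=\beta,\ A+B=2C\}\cup\{\gamma=0,\ \alpha=-\beta,\ A+B=-2C\}$. *)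

theory Defs
  imports "HOL-Analysis.Analysis" "HOL-Algebra.Bij" "HOL-Algebra.Group_Action"
    "HOL-Algebra.Elementary_Groups"
begin

(* The tuple (A, B, C, \<alpha>, \<beta>, \<gamma>) stands for the Killing 2-tensor of the Minkowski plane with
   contravariant components, in pseudo-Cartesian coordinates (t, x),
     K11 = A + 2 \<alpha> x + \<gamma> x^2,
     K12 = K21 = C + \<alpha> t + \<beta> x + \<gamma> t x,
     K22 = B + 2 \<beta> t + \<gamma> t^2. *)
type_synonym killing = "real \<times> real \<times> real \<times> real \<times> real \<times> real"

fun V1 :: "killing \<Rightarrow> killing" where
  "V1 (A, B, C, \<alpha>, \<beta>, \<gamma>) = (0, - 2 * \<beta>, - \<alpha>, 0, - \<gamma>, 0)"

fun V2 :: "killing \<Rightarrow> killing" where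
  "V2 (A, B, C, \<alpha>, \<beta>, \<gamma>) = (- 2 * \<alpha>, 0, - \<beta>, - \<gamma>, 0, 0)"

fun V3 :: "killing \<Rightarrow> killing" where
  "V3 (A, B, C, \<alpha>, \<beta>, \<gamma>) = (2 * C, 2 * C, A + B, \<beta>, \<alpha>, 0)"

fun V4 :: "killing \<Rightarrow> killing" where
  "V4 (A, B, C, \<alpha>, \<beta>, \<gamma>) = (2 * A, 2 * B, 2 * C, \<alpha>, \<beta>, 0)"

fun V5 :: "killing \<Rightarrow> killing" where
  "V5 (A, B, C, \<alpha>, \<beta>, \<gamma>) = (1, - 1, 0, 0, 0, 0)"

fun V6 :: "killing \<Rightarrow> killing" where
  "V6 (A, B, C, \<alpha>, \<beta>, \<gamma>) = (A, B, C, \<alpha>, \<beta>, \<gamma>)"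

fun R0 :: "killing \<Rightarrow> killing" where
  "R0 (A, B, C, \<alpha>, \<beta>, \<gamma>) = (- A, - B, - C, - \<alpha>, - \<beta>, - \<gamma>)"

fun R1 :: "killing \<Rightarrow> killing" where
  "R1 (A, B, C, \<alpha>, \<beta>, \<gamma>) = (A, B, - C, - \<alpha>, \<beta>, \<gamma>)"

fun R2 :: "killing \<Rightarrow> killing" where
  "R2 (A, B, C, \<alpha>, \<beta>, \<gamma>) = (A, B, - C, \<alpha>, - \<beta>, \<gamma>)"

(* Complete flow, as a one-parameter group of transformations. V1, ..., V6 are affine, so each of
   them has exactly one. *)
definition is_flow :: "('a::real_normed_vector \<Rightarrow> 'a) \<Rightarrow> (real \<Rightarrow> 'a \<Rightarrow> 'a) \<Rightarrow> bool" where
  "is_flow V \<Phi> \<longleftrightarrow>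
     \<Phi> 0 = id \<and>
     (\<forall>s t. \<Phi> (s + t) = \<Phi> s \<circ> \<Phi> t) \<and>
     (\<forall>K t. ((\<lambda>s. \<Phi> s K) has_vector_derivative V (\<Phi> t K)) (at t))"

definition generators_M :: "(killing \<Rightarrow> killing) set" where
  "generators_M =
     {\<Phi> t | V \<Phi> t. V \<in> {V1, V2, V3, V4, V5, V6} \<and> is_flow V \<Phi>} \<union> {R0, R1, R2}"

(* The carrier of a subgroup_generated only takes the generators lying in the group; here these
   are all of them. *)
lemma generators_M_subset: "generators_M \<subseteq> carrier (BijGroup UNIV)"
proof
  fix g assume "g \<in> generators_M"
  then consider "g \<in> {R0, R1, R2}" | V \<Phi> t where "g = \<Phi> t" "is_flow V \<Phi>"
    unfolding generators_M_def by blast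
  then have "\<exists>h. g \<circ> h = id \<and> h \<circ> g = id"
  proof cases
    case 1
    then have "g \<circ> g = id" by (auto simp: fun_eq_iff)
    then show ?thesis by blast
  next
    case 2
    have "\<Phi> t \<circ> \<Phi> (- t) = \<Phi> (t + - t)" "\<Phi> (- t) \<circ> \<Phi> t = \<Phi> (- t + t)" "\<Phi> 0 = id"
      using 2(2) unfolding is_flow_def by metis+
    then show ?thesis using 2(1) by auto
  qed
  then have "bij g" using o_bij by blast
  then show "g \<in> carrier (BijGroup UNIV)"
    by (simp add: BijGroup_def Bij_def)
qed

definition G_M :: "(killing \<Rightarrow> killing) monoid" where
  "G_M = subgroup_generated (BijGroup UNIV) generators_M"

definition S1 :: "killing set" where
  "S1 = {(A, B, C, \<alpha>, \<beta>, \<gamma>). \<gamma> = 0}"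

definition S2 :: "killing set" where
  "S2 = {(A, B, C, \<alpha>, \<beta>, \<gamma>).
     (\<gamma> * (A + B - 2 * C) - (\<alpha> - \<beta>)\<^sup>2) * (\<gamma> * (A + B + 2 * C) - (\<alpha> + \<beta>)\<^sup>2) = 0}"

definition S3 :: "killing set" where
  "S3 = {(A, B, C, \<alpha>, \<beta>, \<gamma>). \<gamma> * (A + B) = \<alpha>\<^sup>2 + \<beta>\<^sup>2 \<and> \<gamma> * C = \<alpha> * \<beta>}"

definition S4 :: "killing set" where
  "S4 = {(A, B, C, \<alpha>, \<beta>, \<gamma>). \<gamma> = 0 \<and> \<alpha> = \<beta> \<and> A + B = 2 * C} \<union>
        {(A, B, C, \<alpha>, \<beta>, \<gamma>). \<gamma> = 0 \<and> \<alpha> = - \<beta> \<and> A + B = - 2 * C}"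

end

theory Submission
  imports Defs
begin

text \<open>
  On \<open>\<gamma> = 0\<close> the equation of \<open>S2\<close> reads \<open>(\<alpha> - \<beta>)\<^sup>2 (\<alpha> + \<beta>)\<^sup>2 = 0\<close>, so \<open>\<beta> = \<sigma> \<alpha>\<close> for a sign
  \<open>\<sigma>\<close>. Removing \<open>S3\<close> then means \<open>\<alpha> \<noteq> 0\<close>, and removing \<open>S4\<close> means \<open>A + B - 2 \<sigma> C \<noteq> 0\<close>. Hence the
  region is the disjoint union of eight cells, indexed by \<open>\<sigma>\<close>, the sign of \<open>\<alpha>\<close> and the sign of
  \<open>A + B - 2 \<sigma> C\<close>. Each cell is cut out by linear equations and strict linear inequalities, so it is
  convex. It is also relatively open in the region, because the three signs cannot change without
  \<open>\<alpha>\<close> or \<open>A + B - 2 \<sigma> C\<close> vanishing. Therefore the cells are the components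
  (\<open>components_region\<close>, \<open>card_cells\<close>).

  The reflection \<open>R2\<close> flips only \<open>\<sigma>\<close>, \<open>R1\<close> flips \<open>\<sigma>\<close> and the sign of \<open>\<alpha>\<close>, and \<open>R0\<close> flips the last
  two signs. These three sign changes generate \<open>(\<int>/2)\<^sup>3\<close>, so any two cells are linked
  (\<open>linked_cells\<close>).

  It remains to see that the region is a single orbit. It is invariant because every flow maps each
  cell into itself (\<open>flow_preserves_cell\<close>): along an integral curve the linear functionals that
  define a cell satisfy scalar equations \<open>y' = c y\<close>, hence they are multiplied by positive
  exponentials. Conversely the flows are transitive on the cell of \<open>(1, 0, 0, 1, 1, 0)\<close>
  (\<open>transitive_on_cell\<close>): the scalings \<open>V6\<close> and \<open>V4\<close> adjust \<open>\<alpha>\<close> and \<open>A + B - 2 C\<close>, which are the two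
  nonzero data, and the flows of \<open>V5\<close> and \<open>V1\<close> reach the remaining coordinates. Words in the
  \<open>R\<close>'s carry this cell to the other seven.
\<close>

section \<open>Components of a set partitioned into relatively open connected pieces\<close>

text \<open>
  The complement of a piece is a union of pieces, so each piece is clopen, and a connected set that
  meets a clopen set lies inside it. The pieces only have to be open in \<open>S\<close>: this matters here,
  where \<open>S\<close> has codimension two.
\<close>

lemma components_relatively_open_unique:
  fixes S :: "'a::topological_space set"
  assumes disj: "pairwise disjnt \<A>" and un: "\<Union>\<A> = S"
    and piece: "\<And>U. U \<in> \<A> \<Longrightarrow> openin (top_of_set S) U \<and> connected U \<and> U \<noteq> {}"
  shows "components S = \<A>"
proof -
  have max: "D \<subseteq> U" if U: "U \<in> \<A>" and D: "connected D" "D \<subseteq> S" "D \<inter> U \<noteq> {}" for U D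
  proof -
    have "S - U = \<Union>(\<A> - {U})"
      using un U disj by (auto simp: pairwise_def disjnt_iff)
    then have "openin (top_of_set S) (S - U)"
      using piece by (auto intro: openin_Union)
    then have "closedin (top_of_set S) U"
      using un U by (auto simp: closedin_def double_diff)
    then have "openin (top_of_set D) (D \<inter> U)" "closedin (top_of_set D) (D \<inter> U)"
      using piece[OF U] D(2)
      by (metis inf.absorb_iff2 inf_assoc openin_open inf_commute)
        (metis \<open>closedin (top_of_set S) U\<close> D(2) inf.absorb_iff2 inf_assoc closedin_closed inf_commute)
    then show ?thesis
      using D connected_clopen by (metis inf.orderI)
  qed
  show ?thesis
  proof
    show "components S \<subseteq> \<A>"
    proof
      fix C assume C: "C \<in> components S"
      then have C': "C \<noteq> {}" "C \<subseteq> S" "connected C"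
        by (auto simp: in_components_maximal)
      then obtain U where U: "U \<in> \<A>" "C \<inter> U \<noteq> {}"
        using un by blast
      then have "C \<subseteq> U"
        using max C' by blast
      then have "U = C"
        using C U piece un unfolding in_components_maximal by blast
      then show "C \<in> \<A>" using U by simp
    qed
    show "\<A> \<subseteq> components S"
    proof
      fix U assume U: "U \<in> \<A>"
      have "D = U" if "D \<noteq> {}" "U \<subseteq> D" "D \<subseteq> S" "connected D" for D
        using max[OF U, of D] that piece[OF U] by blast
      then show "U \<in> components S"
        using piece[OF U] U un unfolding in_components_maximal by blast
    qed
  qed
qed

section \<open>Eigenfunctionals of a flow\<close>

text \<open>
  A functional that is an eigenvector of \<open>V\<close> along a single integral curve solves \<open>y' = c y\<close> there.
  The eigenvalue equation is required only on the curve, so that one functional may be used once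
  others are known to vanish on the curve. No explicit formula for the flow is involved, which
  covers every \<open>\<Phi>\<close> satisfying \<open>is_flow V \<Phi>\<close>.
\<close>

lemma flow_eigenfunctional:
  fixes L :: "'a::real_normed_vector \<Rightarrow> real"
  assumes L: "bounded_linear L" and flow: "is_flow V \<Phi>"
    and eig: "\<And>s. L (V (\<Phi> s K)) = c * L (\<Phi> s K)"
  shows "L (\<Phi> t K) = exp (c * t) * L K"
proof -
  define f where "f = (\<lambda>s. exp (- c * s) * L (\<Phi> s K))"
  have "((\<lambda>s. L (\<Phi> s K)) has_real_derivative c * L (\<Phi> s K)) (at s)" for s
    using bounded_linear.has_vector_derivative[OF L, of "\<lambda>s. \<Phi> s K" "V (\<Phi> s K)" "at s"] flow
    unfolding is_flow_def by (simp add: eig has_real_derivative_iff_has_vector_derivative)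
  then have "(f has_real_derivative 0) (at s)" for s
    unfolding f_def by (auto intro!: derivative_eq_intros)
  then have "f t = f 0"
    using DERIV_isconst_all by blast
  moreover have "\<Phi> 0 K = K"
    using flow unfolding is_flow_def by simp
  ultimately have "exp (- c * t) * L (\<Phi> t K) = L K"
    by (simp add: f_def)
  then have "exp (c * t) * (exp (- c * t) * L (\<Phi> t K)) = exp (c * t) * L K"
    by simp
  then show ?thesis
    by (simp add: mult.assoc[symmetric] exp_add[symmetric])
qed

section \<open>The eight cells\<close>

definition gamma_coord :: "killing \<Rightarrow> real" where
  "gamma_coord = (\<lambda>(A, B, C, \<alpha>, \<beta>, \<gamma>). \<gamma>)"

definition alpha_coord :: "killing \<Rightarrow> real" where
  "alpha_coord = (\<lambda>(A, B, C, \<alpha>, \<beta>, \<gamma>). \<alpha>)"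

definition beta_defect :: "real \<Rightarrow> killing \<Rightarrow> real" where
  "beta_defect \<sigma> = (\<lambda>(A, B, C, \<alpha>, \<beta>, \<gamma>). \<beta> - \<sigma> * \<alpha>)"

text \<open>
  The covector \<open>(1, - \<sigma>)\<close> is null when \<open>\<sigma>\<^sup>2 = 1\<close>, and this is the value on it of the quadratic
  form of the tensor at the origin. For such \<open>\<sigma>\<close>, if \<open>\<gamma> = 0\<close> and \<open>\<beta> = \<sigma> \<alpha>\<close>, that value is the same at all points of
  the plane; therefore translations do not change it.
\<close>

definition null_value :: "real \<Rightarrow> killing \<Rightarrow> real" where
  "null_value \<sigma> = (\<lambda>(A, B, C, \<alpha>, \<beta>, \<gamma>). A + B - 2 * \<sigma> * C)"

lemmas functional_defs = gamma_coord_def alpha_coord_def beta_defect_def null_value_def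

lemma bounded_linear_functionals:
  "bounded_linear gamma_coord" "bounded_linear alpha_coord"
  "bounded_linear (beta_defect \<sigma>)" "bounded_linear (null_value \<sigma>)"
  unfolding linear_conv_bounded_linear[symmetric]
  by (auto intro!: linearI simp: functional_defs algebra_simps)

text \<open>
  The indices are real numbers, so that a sign condition on \<open>x\<close> becomes the inequality
  \<open>0 < \<epsilon> * x\<close>, and the effect of a reflection on a cell is a change of sign in its index.
\<close>

definition cell :: "real \<times> real \<times> real \<Rightarrow> killing set" where
  "cell = (\<lambda>(\<sigma>, \<epsilon>, \<delta>).
     {K. gamma_coord K = 0 \<and> beta_defect \<sigma> K = 0 \<and> 0 < \<epsilon> * alpha_coord K \<and> 0 < \<delta> * null_value \<sigma> K})"

definition signs :: "(real \<times> real \<times> real) set" where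
  "signs = {1, -1} \<times> {1, -1} \<times> {1, -1}"

lemma mem_cell:
  "(A, B, C, \<alpha>, \<beta>, \<gamma>) \<in> cell (\<sigma>, \<epsilon>, \<delta>) \<longleftrightarrow>
     \<gamma> = 0 \<and> \<beta> = \<sigma> * \<alpha> \<and> 0 < \<epsilon> * \<alpha> \<and> 0 < \<delta> * (A + B - 2 * \<sigma> * C)"
  by (auto simp: cell_def functional_defs)

lemma region_eq_cells: "(S1 \<inter> S2) - (S3 \<union> S4) = \<Union>(cell ` signs)"
proof (intro equalityI subsetI)
  fix K assume K: "K \<in> (S1 \<inter> S2) - (S3 \<union> S4)"
  obtain A B C \<alpha> \<beta> \<gamma> where t: "K = (A, B, C, \<alpha>, \<beta>, \<gamma>)"
    by (metis prod_cases6)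
  define \<sigma> :: real where "\<sigma> = (if \<alpha> = \<beta> then 1 else -1)"
  have "\<gamma> = 0" and null: "\<alpha> = \<beta> \<or> \<alpha> = - \<beta>" and "\<alpha> \<noteq> 0"
    using K by (auto simp: t S1_def S2_def S3_def)
  moreover have "\<beta> = \<sigma> * \<alpha>" "A + B - 2 * \<sigma> * C \<noteq> 0"
    using K null by (auto simp: t \<sigma>_def S1_def S4_def)
  ultimately have "K \<in> cell (\<sigma>, sgn \<alpha>, sgn (A + B - 2 * \<sigma> * C))"
    by (auto simp: t mem_cell sgn_if)
  moreover have "(\<sigma>, sgn \<alpha>, sgn (A + B - 2 * \<sigma> * C)) \<in> signs"
    using \<open>\<alpha> \<noteq> 0\<close> \<open>A + B - 2 * \<sigma> * C \<noteq> 0\<close> by (auto simp: signs_def \<sigma>_def sgn_if)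
  ultimately show "K \<in> \<Union>(cell ` signs)" by blast
next
  fix K assume K: "K \<in> \<Union>(cell ` signs)"
  obtain A B C \<alpha> \<beta> \<gamma> where "K = (A, B, C, \<alpha>, \<beta>, \<gamma>)"
    by (metis prod_cases6)
  with K show "K \<in> (S1 \<inter> S2) - (S3 \<union> S4)"
    by (auto simp: signs_def mem_cell S1_def S2_def S3_def S4_def)
qed

lemma convex_linear_conditions:
  fixes L :: "'a::real_normed_vector \<Rightarrow> real"
  assumes "linear L"
  shows "convex {K. L K = 0}" "convex {K. 0 < c * L K}"
proof -
  show "convex {K. L K = 0}"
    by (intro convexI) (simp add: linear_add[OF assms] linear_cmul[OF assms])
  have "0 < c * (u * a + v * b)" if "0 < c * a" "0 < c * b" "0 \<le> u" "0 \<le> v" "u + v = 1" for a b u v :: real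
    using convexD[OF convex_real_interval(3)[of 0], of "c * a" "c * b" u v] that
    by (simp add: algebra_simps)
  then show "convex {K. 0 < c * L K}"
    by (intro convexI) (simp add: linear_add[OF assms] linear_cmul[OF assms])
qed

lemma connected_cell: "connected (cell i)"
proof -
  obtain \<sigma> \<epsilon> \<delta> where i: "i = (\<sigma>, \<epsilon>, \<delta>)" by (cases i)
  have "cell i = {K. gamma_coord K = 0} \<inter> {K. beta_defect \<sigma> K = 0} \<inter> {K. 0 < \<epsilon> * alpha_coord K} \<inter> {K. 0 < \<delta> * null_value \<sigma> K}"
    by (auto simp: i cell_def)
  moreover have "convex \<dots>"
    by (intro convex_Int convex_linear_conditions bounded_linear.linear bounded_linear_functionals)
  ultimately show ?thesis by (simp add: convex_connected)
qed

lemma cell_nonempty: "i \<in> signs \<Longrightarrow> cell i \<noteq> {}"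
proof -
  assume "i \<in> signs"
  then obtain \<sigma> \<epsilon> \<delta> where i: "i = (\<sigma>, \<epsilon>, \<delta>)" "\<epsilon> * \<epsilon> = 1" "\<delta> * \<delta> = 1"
    by (auto simp: signs_def)
  then have "(\<delta>, 0, 0, \<epsilon>, \<sigma> * \<epsilon>, 0) \<in> cell i"
    by (simp add: mem_cell)
  then show ?thesis by blast
qed

lemma cells_disjoint: "i \<in> signs \<Longrightarrow> j \<in> signs \<Longrightarrow> i \<noteq> j \<Longrightarrow> cell i \<inter> cell j = {}"
  by (auto simp: signs_def mem_cell)

text \<open>
  Within the region \<open>\<alpha> \<beta> = \<sigma> \<alpha>\<^sup>2\<close>, so \<open>\<sigma>\<close> is the sign of the continuous function \<open>\<alpha> \<beta>\<close>. This
  replaces the closed condition \<open>\<beta> = \<sigma> \<alpha>\<close> by an open one.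
\<close>

lemma openin_cell:
  assumes "i \<in> signs"
  shows "openin (top_of_set (\<Union>(cell ` signs))) (cell i)"
proof -
  obtain \<sigma> \<epsilon> \<delta> where i: "i = (\<sigma>, \<epsilon>, \<delta>)" by (cases i)
  with assms have \<sigma>: "\<sigma> = 1 \<or> \<sigma> = -1" by (auto simp: signs_def)
  \<comment> \<open>The functional \<open>beta_defect 0\<close> is the coordinate \<open>\<beta>\<close>.\<close>
  define W :: "killing set" where
    "W = {K. 0 < \<sigma> * (alpha_coord K * (beta_defect 0 K))} \<inter> {K. 0 < \<epsilon> * alpha_coord K} \<inter> {K. 0 < \<delta> * null_value \<sigma> K}"
  have cont: "continuous_on UNIV alpha_coord" "continuous_on UNIV (beta_defect 0)" "continuous_on UNIV (null_value \<sigma>)"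
    by (intro linear_continuous_on bounded_linear_functionals)+
  have "open W"
    unfolding W_def by (intro open_Int open_Collect_less continuous_intros cont)
  moreover have "cell i = \<Union>(cell ` signs) \<inter> W"
  proof (intro equalityI subsetI)
    fix K assume K: "K \<in> cell i"
    obtain A B C \<alpha> \<beta> \<gamma> where t: "K = (A, B, C, \<alpha>, \<beta>, \<gamma>)"
      by (metis prod_cases6)
    have "\<alpha> \<noteq> 0" and \<beta>: "\<beta> = \<sigma> * \<alpha>"
      using K by (auto simp: i t mem_cell)
    then have "0 < \<sigma> * (\<alpha> * \<beta>)"
      using \<sigma> zero_less_mult_iff[of \<alpha> \<alpha>] by (auto simp: linorder_neq_iff)
    with K have "K \<in> W"
      by (auto simp: i t W_def cell_def functional_defs)
    with K assms show "K \<in> \<Union>(cell ` signs) \<inter> W" by blast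
  next
    fix K assume K: "K \<in> \<Union>(cell ` signs) \<inter> W"
    obtain A B C \<alpha> \<beta> \<gamma> where t: "K = (A, B, C, \<alpha>, \<beta>, \<gamma>)"
      by (metis prod_cases6)
    from K obtain \<sigma>' \<epsilon>' \<delta>' where j: "(\<sigma>', \<epsilon>', \<delta>') \<in> signs" "K \<in> cell (\<sigma>', \<epsilon>', \<delta>')"
      by auto
    then have \<sigma>': "\<sigma>' = 1 \<or> \<sigma>' = -1" "\<gamma> = 0" "\<beta> = \<sigma>' * \<alpha>"
      by (auto simp: t signs_def mem_cell)
    have "0 < \<sigma> * (\<alpha> * \<beta>)"
      using K by (simp add: t W_def functional_defs)
    then have "\<sigma>' = \<sigma>"
      using \<sigma> \<sigma>' by (auto simp: zero_less_mult_iff)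
    with K \<sigma>' show "K \<in> cell i"
      by (auto simp: i t W_def cell_def functional_defs)
  qed
  ultimately show ?thesis by (auto simp: openin_open)
qed

lemma components_region: "components (\<Union>(cell ` signs)) = cell ` signs"
proof (rule components_relatively_open_unique)
  show "pairwise disjnt (cell ` signs)"
    using cells_disjoint unfolding pairwise_def disjnt_def by blast
qed (auto simp: openin_cell connected_cell cell_nonempty)

lemma card_cells: "card (cell ` signs) = 8"
proof -
  have "inj_on cell signs"
    using cells_disjoint cell_nonempty by (metis inf.idem inj_onI)
  then show ?thesis
    by (simp add: card_image signs_def card_cartesian_product)
qed

section \<open>The discrete transformations permute the cells\<close>

lemma image_involution_eq:
  assumes "\<And>x. R (R x) = x" "\<And>x. x \<in> P \<Longrightarrow> R x \<in> Q" "\<And>x. x \<in> Q \<Longrightarrow> R x \<in> P"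
  shows "R ` P = Q"
  using assms by (metis image_subsetI subset_antisym subsetI imageI)

lemma R_involutive: "R0 (R0 K) = K" "R1 (R1 K) = K" "R2 (R2 K) = K"
  by (cases K; simp)+

lemma R_mem_cell:
  assumes "K \<in> cell (\<sigma>, \<epsilon>, \<delta>)"
  shows "R0 K \<in> cell (\<sigma>, - \<epsilon>, - \<delta>)" "R1 K \<in> cell (- \<sigma>, - \<epsilon>, \<delta>)" "R2 K \<in> cell (- \<sigma>, \<epsilon>, \<delta>)"
  using assms by (cases K; simp add: mem_cell algebra_simps)+

lemma R_cell:
  "R0 ` cell (\<sigma>, \<epsilon>, \<delta>) = cell (\<sigma>, - \<epsilon>, - \<delta>)"
  "R1 ` cell (\<sigma>, \<epsilon>, \<delta>) = cell (- \<sigma>, - \<epsilon>, \<delta>)"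
  "R2 ` cell (\<sigma>, \<epsilon>, \<delta>) = cell (- \<sigma>, \<epsilon>, \<delta>)"
  using R_mem_cell(1)[of _ \<sigma> "- \<epsilon>" "- \<delta>"] R_mem_cell(2)[of _ "- \<sigma>" "- \<epsilon>" \<delta>]
    R_mem_cell(3)[of _ "- \<sigma>" \<epsilon> \<delta>]
  by (intro image_involution_eq R_involutive R_mem_cell; simp)+

definition linked :: "killing set \<Rightarrow> killing set \<Rightarrow> bool" where
  "linked P Q \<longleftrightarrow> (\<exists>rs. set rs \<subseteq> {R0, R1, R2} \<and> foldr (\<circ>) rs id ` P = Q)"

lemma linked_refl: "linked P P"
  unfolding linked_def by (rule exI[of _ "[]"]) simp

lemma linked_step:
  assumes "linked P Q" "R \<in> {R0, R1, R2}"
  shows "linked P (R ` Q)"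
proof -
  obtain rs where rs: "set rs \<subseteq> {R0, R1, R2}" "foldr (\<circ>) rs id ` P = Q"
    using assms(1) unfolding linked_def by (elim exE conjE)
  have "set (R # rs) \<subseteq> {R0, R1, R2}"
    using rs(1) assms(2) by simp
  moreover have "foldr (\<circ>) (R # rs) id ` P = R ` Q"
    by (simp only: foldr_Cons o_apply image_comp flip: rs(2))
  ultimately show ?thesis
    unfolding linked_def by (intro exI conjI)
qed

text \<open>
  The sign \<open>\<sigma>\<close> alone is flipped by \<open>R2\<close>, the sign \<open>\<epsilon>\<close> alone by \<open>R1 \<circ> R2\<close>, and the sign \<open>\<delta>\<close> alone
  by \<open>R0 \<circ> R1 \<circ> R2\<close>.
\<close>

lemma linked_cells:
  assumes "i \<in> signs" "j \<in> signs"
  shows "linked (cell i) (cell j)"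
proof -
  have s: "linked P (cell (- \<sigma>, \<epsilon>, \<delta>))" "linked P (cell (\<sigma>, - \<epsilon>, \<delta>))" "linked P (cell (\<sigma>, \<epsilon>, - \<delta>))"
    if "linked P (cell (\<sigma>, \<epsilon>, \<delta>))" for P \<sigma> \<epsilon> \<delta>
  proof -
    show 1: "linked P (cell (- \<sigma>, \<epsilon>, \<delta>))"
      using linked_step[OF that, of R2] by (simp add: R_cell)
    show 2: "linked P (cell (\<sigma>, - \<epsilon>, \<delta>))"
      using linked_step[OF 1, of R1] by (simp add: R_cell)
    show "linked P (cell (\<sigma>, \<epsilon>, - \<delta>))"
      using linked_step[OF 2, of R0] by (simp add: R_cell)
  qed
  obtain \<sigma> \<epsilon> \<delta> \<sigma>' \<epsilon>' \<delta>' where ij: "i = (\<sigma>, \<epsilon>, \<delta>)" "j = (\<sigma>', \<epsilon>', \<delta>')"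
    by (cases i, cases j)
  have "\<sigma>' = \<sigma> \<or> \<sigma>' = - \<sigma>" "\<epsilon>' = \<epsilon> \<or> \<epsilon>' = - \<epsilon>" "\<delta>' = \<delta> \<or> \<delta>' = - \<delta>"
    using assms by (auto simp: ij signs_def)
  then show ?thesis
    unfolding ij using linked_refl[of "cell (\<sigma>, \<epsilon>, \<delta>)"] s by (elim disjE) auto
qed

section \<open>The flows preserve each cell\<close>

text \<open>
  The functionals form a triangular system: \<open>\<gamma>\<close> is an eigenvector of each \<open>V\<close>, then \<open>\<beta> - \<sigma> \<alpha>\<close> is
  one where \<open>\<gamma> = 0\<close>, then \<open>\<alpha>\<close> and \<open>A + B - 2 \<sigma> C\<close> are where both vanish. The first two stay zero
  and the last two keep their signs.
\<close>

lemma flow_preserves_cell: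
  assumes V: "V \<in> {V1, V2, V3, V4, V5, V6}" and flow: "is_flow V \<Phi>"
    and i: "i \<in> signs" and K: "K \<in> cell i"
  shows "\<Phi> t K \<in> cell i"
proof -
  obtain \<sigma> \<epsilon> \<delta> where i': "i = (\<sigma>, \<epsilon>, \<delta>)" by (cases i)
  with i have \<sigma>: "\<sigma> = 1 \<or> \<sigma> = -1" by (auto simp: signs_def)
  define E where "E V a b c d \<longleftrightarrow> (\<forall>K.
      gamma_coord (V K) = a * gamma_coord K \<and>
      (gamma_coord K = 0 \<longrightarrow> beta_defect \<sigma> (V K) = b * beta_defect \<sigma> K) \<and>
      (gamma_coord K = 0 \<and> beta_defect \<sigma> K = 0 \<longrightarrow>
         alpha_coord (V K) = c * alpha_coord K \<and> null_value \<sigma> (V K) = d * null_value \<sigma> K))"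
    for V :: "killing \<Rightarrow> killing" and a b c d
  \<comment> \<open>The boost exchanges \<open>\<alpha>\<close> and \<open>\<beta>\<close>, hence acts on the hyperplane \<open>\<beta> = \<sigma> \<alpha>\<close> through
    \<open>\<sigma>\<close>; the two scalings act by their weights, the translations and \<open>V5\<close> trivially.\<close>
  have "E V1 0 0 0 0" "E V2 0 0 0 0" "E V3 0 (- \<sigma>) \<sigma> (- 2 * \<sigma>)"
       "E V4 0 1 1 2" "E V5 0 0 0 0" "E V6 1 1 1 1"
    using \<sigma> by (auto simp: E_def functional_defs algebra_simps)
  with V obtain a b c d where "E V a b c d" by blast
  note E = this[unfolded E_def, rule_format]
  have K': "gamma_coord K = 0" "beta_defect \<sigma> K = 0" "0 < \<epsilon> * alpha_coord K" "0 < \<delta> * null_value \<sigma> K"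
    using K by (auto simp: i' cell_def)
  note eig = flow_eigenfunctional[OF _ flow]
  have g: "gamma_coord (\<Phi> t K) = 0" for t
    using eig[OF bounded_linear_functionals(1), of K a t] E K'(1) by simp
  have p: "beta_defect \<sigma> (\<Phi> t K) = 0" for t
    using eig[OF bounded_linear_functionals(3), of \<sigma> K b t] E g K'(2) by simp
  have "alpha_coord (\<Phi> t K) = exp (c * t) * alpha_coord K"
    by (rule eig[OF bounded_linear_functionals(2)]) (simp add: E g p)
  moreover have "null_value \<sigma> (\<Phi> t K) = exp (d * t) * null_value \<sigma> K"
    by (rule eig[OF bounded_linear_functionals(4)]) (simp add: E g p)
  ultimately show ?thesis
    using K' g p by (simp add: i' cell_def mult.left_commute[of _ "exp _"])
qed

section \<open>Invariance of the region under the group\<close>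

lemma G_M_carrier: "carrier G_M = generate (BijGroup UNIV) generators_M"
  unfolding G_M_def carrier_subgroup_generated Int_absorb1[OF generators_M_subset] by (rule refl)

lemma G_M_bij:
  assumes "g \<in> carrier G_M"
  shows "g \<in> Bij UNIV"
proof -
  have "g \<in> carrier (BijGroup UNIV)"
    using group.generate_in_carrier[OF group_BijGroup generators_M_subset] assms
    unfolding G_M_carrier .
  then show ?thesis by (simp add: BijGroup_def)
qed

lemma G_M_generator: "g \<in> generators_M \<Longrightarrow> g \<in> carrier G_M"
  unfolding G_M_carrier by (rule generate.incl)

lemma BijGroup_UNIV_mult: "g \<in> Bij UNIV \<Longrightarrow> h \<in> Bij UNIV \<Longrightarrow> g \<otimes>\<^bsub>BijGroup UNIV\<^esub> h = g \<circ> h"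
  by (auto simp: BijGroup_def compose_def)

lemma G_M_comp:
  assumes "g \<in> carrier G_M" "h \<in> carrier G_M"
  shows "g \<circ> h \<in> carrier G_M"
proof -
  have "g \<otimes>\<^bsub>BijGroup UNIV\<^esub> h \<in> carrier G_M"
    using assms unfolding G_M_carrier by (rule generate.eng)
  then show ?thesis
    by (simp only: BijGroup_UNIV_mult[OF assms[THEN G_M_bij]])
qed

lemma BijGroup_UNIV_one: "\<one>\<^bsub>BijGroup UNIV\<^esub> = id"
  by (simp add: BijGroup_def restrict_def id_def)

lemma G_M_id: "id \<in> carrier G_M"
  using generate.one[of "BijGroup UNIV" generators_M]
  by (simp only: G_M_carrier BijGroup_UNIV_one)

lemma discrete_generator: "g \<in> {R0, R1, R2} \<Longrightarrow> g \<in> generators_M"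
  unfolding generators_M_def by (rule UnI2)

lemma flow_generator:
  assumes "V \<in> {V1, V2, V3, V4, V5, V6}" "is_flow V \<Phi>"
  shows "\<Phi> t \<in> generators_M"
  unfolding generators_M_def mem_Collect_eq Un_iff
  by (rule disjI1, rule exI[of _ V], rule exI[of _ \<Phi>], rule exI[of _ t]) (intro conjI refl assms)

lemma generators_M_cases:
  assumes "g \<in> generators_M"
  obtains (discrete) "g \<in> {R0, R1, R2}"
    | (flow) V \<Phi> t where "V \<in> {V1, V2, V3, V4, V5, V6}" "is_flow V \<Phi>" "g = \<Phi> t"
proof (cases "g \<in> {R0, R1, R2}")
  case False
  then have "\<exists>V \<Phi> t. g = \<Phi> t \<and> V \<in> {V1, V2, V3, V4, V5, V6} \<and> is_flow V \<Phi>"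
    using assms unfolding generators_M_def by (simp only: Un_iff mem_Collect_eq simp_thms)
  then show ?thesis
    by (elim exE conjE) (rule flow)
qed (rule discrete)

lemma G_M_discrete_word: "set rs \<subseteq> {R0, R1, R2} \<Longrightarrow> foldr (\<circ>) rs id \<in> carrier G_M"
proof (induction rs)
  case Nil
  have "foldr (\<circ>) [] id = (id :: killing \<Rightarrow> killing)" by simp
  then show ?case by (rule ssubst) (rule G_M_id)
next
  case (Cons R rs)
  have "R \<in> {R0, R1, R2}"
    using Cons.prems by simp
  then have "R \<in> carrier G_M"
    by (intro G_M_generator discrete_generator)
  moreover have "foldr (\<circ>) rs id \<in> carrier G_M"
    using Cons.prems by (intro Cons.IH) simp
  ultimately have "R \<circ> foldr (\<circ>) rs id \<in> carrier G_M"
    by (rule G_M_comp)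
  moreover have "foldr (\<circ>) (R # rs) id = R \<circ> foldr (\<circ>) rs id" by simp
  ultimately show ?case by (rule ssubst[rotated])
qed

text \<open>
  Membership in the generated group also allows inverses of generators; as they are generators
  again, invariance of a set need only be checked for generators, and only as an inclusion.
\<close>

lemma generators_M_inverse:
  assumes "g \<in> generators_M"
  shows "inv\<^bsub>BijGroup UNIV\<^esub> g \<in> generators_M"
proof -
  have "g \<in> Bij UNIV" using assms G_M_bij G_M_generator by blast
  then have inv: "inv\<^bsub>BijGroup UNIV\<^esub> g = inv_into UNIV g"
    by (simp add: inv_BijGroup restrict_def)
  from assms show ?thesis
  proof (cases rule: generators_M_cases)
    case discrete
    then have "g \<circ> g = id" by (auto simp: fun_eq_iff)
    then have "inv_into UNIV g = g" by (intro inv_unique_comp)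
    with assms inv show ?thesis by simp
  next
    case (flow V \<Phi> t)
    have "\<Phi> t \<circ> \<Phi> (- t) = \<Phi> (t + - t)" "\<Phi> (- t) \<circ> \<Phi> t = \<Phi> (- t + t)" "\<Phi> 0 = id"
      using flow(2) unfolding is_flow_def by metis+
    then have "inv_into UNIV g = \<Phi> (- t)"
      unfolding flow(3) by (intro inv_unique_comp) simp_all
    with inv flow_generator[OF flow(1,2)] show ?thesis by simp
  qed
qed

lemma generator_preserves_region:
  assumes "g \<in> generators_M" "K \<in> \<Union>(cell ` signs)"
  shows "g K \<in> \<Union>(cell ` signs)"
proof -
  obtain \<sigma> \<epsilon> \<delta> where i: "(\<sigma>, \<epsilon>, \<delta>) \<in> signs" "K \<in> cell (\<sigma>, \<epsilon>, \<delta>)"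
    using assms(2) by auto
  from assms(1) show ?thesis
  proof (cases rule: generators_M_cases)
    case discrete
    have "(\<sigma>, - \<epsilon>, - \<delta>) \<in> signs" "(- \<sigma>, - \<epsilon>, \<delta>) \<in> signs" "(- \<sigma>, \<epsilon>, \<delta>) \<in> signs"
      using i(1) by (auto simp: signs_def)
    with discrete R_mem_cell[OF i(2)] show ?thesis by auto
  next
    case (flow V \<Phi> t)
    then show ?thesis using flow_preserves_cell[OF flow(1,2) i] i(1) flow(3) by blast
  qed
qed

lemma G_M_preserves_region:
  assumes "g \<in> carrier G_M" "K \<in> \<Union>(cell ` signs)"
  shows "g K \<in> \<Union>(cell ` signs)"
  using assms unfolding G_M_carrier
proof (induction arbitrary: K rule: generate.induct)
  case one
  then show ?case by (simp add: BijGroup_UNIV_one)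
next
  case (incl h)
  then show ?case by (rule generator_preserves_region)
next
  case (inv h)
  then show ?case using generators_M_inverse generator_preserves_region by blast
next
  case (eng g h)
  then have "g \<otimes>\<^bsub>BijGroup UNIV\<^esub> h = g \<circ> h"
    by (intro BijGroup_UNIV_mult G_M_bij) (simp_all add: G_M_carrier)
  with eng show ?case by simp
qed

section \<open>The region as a single orbit\<close>

fun flow1 :: "real \<Rightarrow> killing \<Rightarrow> killing" where
  "flow1 t (A, B, C, \<alpha>, \<beta>, \<gamma>) = (A, B - 2 * \<beta> * t + \<gamma> * t\<^sup>2, C - \<alpha> * t, \<alpha>, \<beta> - \<gamma> * t, \<gamma>)"

fun flow4 :: "real \<Rightarrow> killing \<Rightarrow> killing" where
  "flow4 t (A, B, C, \<alpha>, \<beta>, \<gamma>) =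
     (exp (2 * t) * A, exp (2 * t) * B, exp (2 * t) * C, exp t * \<alpha>, exp t * \<beta>, \<gamma>)"

fun flow5 :: "real \<Rightarrow> killing \<Rightarrow> killing" where
  "flow5 t (A, B, C, \<alpha>, \<beta>, \<gamma>) = (A + t, B - t, C, \<alpha>, \<beta>, \<gamma>)"

fun flow6 :: "real \<Rightarrow> killing \<Rightarrow> killing" where
  "flow6 t (A, B, C, \<alpha>, \<beta>, \<gamma>) =
     (exp t * A, exp t * B, exp t * C, exp t * \<alpha>, exp t * \<beta>, exp t * \<gamma>)"

lemma is_flow_explicit:
  "is_flow V1 flow1" "is_flow V4 flow4" "is_flow V5 flow5" "is_flow V6 flow6"
  unfolding is_flow_def
  by (auto simp: fun_eq_iff exp_add algebra_simps power2_eq_square zero_prod_def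
      intro!: derivative_eq_intros has_vector_derivative_Pair
      simp flip: has_real_derivative_iff_has_vector_derivative)

lemma flows_in_G_M:
  "flow1 t \<in> carrier G_M" "flow4 t \<in> carrier G_M" "flow5 t \<in> carrier G_M" "flow6 t \<in> carrier G_M"
  using is_flow_explicit[THEN flow_generator[rotated], THEN G_M_generator] by simp_all

text \<open>
  For \<open>u = A + B - 2 C\<close>, the two scalings take the base point to \<open>(u, 0, 0, \<alpha>, \<alpha>, 0)\<close>. The flows of
  \<open>V5\<close> and \<open>V1\<close> fix \<open>u\<close> and \<open>\<alpha>\<close>. The first sets \<open>A\<close>; the second sets \<open>C\<close> without moving \<open>A\<close>,
  and then \<open>B\<close> is forced by \<open>u\<close>.
\<close>

lemma transitive_on_cell:
  assumes "K \<in> cell (1, 1, 1)"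
  shows "\<exists>g \<in> carrier G_M. g (1, 0, 0, 1, 1, 0) = K"
proof -
  obtain A B C \<alpha> \<beta> \<gamma> where K: "K = (A, B, C, \<alpha>, \<beta>, \<gamma>)"
    by (metis prod_cases6)
  define u where "u = A + B - 2 * C"
  have m: "\<gamma> = 0" "\<beta> = \<alpha>" "0 < \<alpha>" "0 < u"
    using assms by (auto simp: K mem_cell u_def)
  \<comment> \<open>Under \<open>V6\<close> and \<open>V4\<close> the pair \<open>(u, \<alpha>)\<close> has weights \<open>(1, 1)\<close> and \<open>(2, 1)\<close>; from \<open>(1, 1)\<close> one must
    solve \<open>s + 2 t = ln u\<close> and \<open>s + t = ln \<alpha>\<close>.\<close>
  define s where "s = 2 * ln \<alpha> - ln u"
  define t where "t = ln u - ln \<alpha>"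
  define g where "g = flow1 (- C / \<alpha>) \<circ> (flow5 (2 * C - B) \<circ> (flow4 t \<circ> flow6 s))"
  have "exp (2 * t) * exp s = u" "exp t * exp s = \<alpha>"
    using m by (simp_all add: s_def t_def flip: exp_add)
  then have "g (1, 0, 0, 1, 1, 0) = K"
    using m by (simp add: g_def K) (simp add: u_def)
  moreover have "g \<in> carrier G_M"
    unfolding g_def by (intro G_M_comp flows_in_G_M)
  ultimately show ?thesis by blast
qed

lemma orbit_region: "orbit G_M (\<lambda>g. g) (1, 0, 0, 1, 1, 0) = \<Union>(cell ` signs)"
proof
  have base: "(1, 1, 1) \<in> signs" by (simp add: signs_def)
  have "(1, 0, 0, 1, 1, 0) \<in> cell (1, 1, 1)" by (simp add: mem_cell)
  then show "orbit G_M (\<lambda>g. g) (1, 0, 0, 1, 1, 0) \<subseteq> \<Union>(cell ` signs)"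
    using G_M_preserves_region base unfolding orbit_def by blast
  show "\<Union>(cell ` signs) \<subseteq> orbit G_M (\<lambda>g. g) (1, 0, 0, 1, 1, 0)"
  proof
    fix K assume "K \<in> \<Union>(cell ` signs)"
    then obtain i where "i \<in> signs" "K \<in> cell i" by blast
    from linked_cells[OF base \<open>i \<in> signs\<close>] obtain rs where rs: "set rs \<subseteq> {R0, R1, R2}"
      and "foldr (\<circ>) rs id ` cell (1, 1, 1) = cell i"
      unfolding linked_def by (elim exE conjE)
    then have "K \<in> foldr (\<circ>) rs id ` cell (1, 1, 1)"
      using \<open>K \<in> cell i\<close> by simp
    then obtain K' where K': "K = foldr (\<circ>) rs id K'" "K' \<in> cell (1, 1, 1)"
      by (rule imageE)
    obtain g where g: "g \<in> carrier G_M" "g (1, 0, 0, 1, 1, 0) = K'"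
      using transitive_on_cell[OF K'(2)] by (elim bexE)
    have "foldr (\<circ>) rs id \<circ> g \<in> carrier G_M"
      by (intro G_M_comp G_M_discrete_word rs g)
    moreover have "K = (foldr (\<circ>) rs id \<circ> g) (1, 0, 0, 1, 1, 0)"
      by (simp only: comp_apply g(2) K'(1))
    ultimately show "K \<in> orbit G_M (\<lambda>g. g) (1, 0, 0, 1, 1, 0)"
      unfolding orbit_def mem_Collect_eq by (intro exI conjI)
  qed
qed

theorem proposition24:
  fixes X :: "killing set"
  defines "X \<equiv> (S1 \<inter> S2) - (S3 \<union> S4)"
  shows "card (components X) = 8
    \<and> (\<forall>P \<in> components X. \<forall>Q \<in> components X.
         \<exists>rs. set rs \<subseteq> {R0, R1, R2} \<and> foldr (\<circ>) rs id ` P = Q)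
    \<and> X \<in> orbits G_M UNIV (\<lambda>g. g)"
proof (intro conjI ballI)
  have X: "X = \<Union>(cell ` signs)"
    unfolding X_def by (rule region_eq_cells)
  show "card (components X) = 8"
    by (simp add: X components_region card_cells)
  show "\<exists>rs. set rs \<subseteq> {R0, R1, R2} \<and> foldr (\<circ>) rs id ` P = Q"
    if "P \<in> components X" "Q \<in> components X" for P Q
    unfolding linked_def[symmetric]
    using that linked_cells by (auto simp: X components_region)
  show "X \<in> orbits G_M UNIV (\<lambda>g. g)"
    unfolding X orbit_region[symmetric] orbits_def by blast
qed

end
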